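(* Let $p$ be an odd prime and let $c$ be an integer. Let $D_p(c)=\left[(i^2+cij+j^2)^{p-2}\right]_{1\le i,j\le p-1}$. Then the following hold. (1) If $c\equiv\pm2\pmod{p}$, then $p\mid\det D_p(c)$. (2) If $\left(\frac{c^2-4}{p}\right)=1$, then there exists $x\in\mathbb{Z}$ such that $$\det D_p(c)\equiv x^2\left(\frac{-c-2}{p}\right)\pmod{p}.$$ (3) If $\left(\frac{c^2-4}{p}\right)=-1$, then there exists $x\in\mathbb{Z}$ such that $$\det D_p(c)\equiv 2cx^2\left(\frac{-c-2}{p}\right)\pmod{p}.$$
   Context: $\left(\frac{\cdot}{p}\right)$ denotes the Legendre symbol modulo the odd prime $p$ (with value $0$ on multiples of $p$). $D_p(c)$ is the $(p-1)\times(p-1)$ integer matrix whose $(i,j)$ entry is $(i^2+cij+j^2)^{p-2}$, $1\le i,j\le p-1$.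
   Formalization: Part (1) is stated only for p ≠ 3, since it fails at p = 3: for c = 1 the determinant is −13 and for c = 2 it is −17, neither divisible by 3; parts (2) and (3) are stated for every odd prime. *)

theory Defs
  imports
    "Jordan_Normal_Form.Determinant"
    "HOL-Number_Theory.Residues"
begin

text \<open>Matrices are indexed from \<open>0\<close> in the library, so the entry at position \<open>(i, j)\<close> below is
  the one written with row index \<open>i + 1\<close> and column index \<open>j + 1\<close> on paper. The exponent \<open>p - 2\<close> uses
  truncated subtraction and is the intended one for \<open>p \<ge> 2\<close>.\<close>

definition D_mat :: "nat \<Rightarrow> int \<Rightarrow> int mat" where
  "D_mat p c = mat (p - 1) (p - 1)
     (\<lambda>(i, j). ((int (i + 1))\<^sup>2 + c * int (i + 1) * int (j + 1) + (int (j + 1))\<^sup>2) ^ (p - 2))"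

end

theory Submission
  imports
    Defs
    "HOL-Number_Theory.Number_Theory"
    "HOL-Computational_Algebra.Polynomial_FPS"
begin

text \<open>Work modulo \<open>p\<close> and put \<open>g = 1 + c X + X\<^sup>2\<close>. Multiplying column \<open>j\<close> of the matrix by \<open>j\<^sup>2\<close> turns
  the entries into values of \<open>g\<^bsup>p-2\<^esup>\<close> at \<open>i / j\<close>. Reducing the exponents of this polynomial modulo
  \<open>p - 1\<close> to get coefficients \<open>a\<^sub>0, \<dots>, a\<^bsub>p-2\<^esub>\<close> therefore diagonalises the matrix, and the determinant
  is \<open>\<Prod>a\<^sub>k\<close>. As \<open>g\<close> is palindromic, \<open>a\<^sub>k = a\<^bsub>p-3-k\<^esub>\<close>, so that the determinant is a square times
  \<open>a\<^bsub>p-2\<^esub> a\<^sub>m\<close> with \<open>m = (p - 3) / 2\<close>.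

  Since \<open>g\<^sup>p \<equiv> 1 + c X\<^sup>p + X\<^bsup>2p\<^esup>\<close>, both remaining factors are coefficients of \<open>h\<^sup>2\<close> where \<open>h = 1 / g\<close>, and
  \<open>(c\<^sup>2 - 4) h\<^sup>2 = - 2 h - (g' h)'\<close> expresses them by the coefficients of \<open>h\<close>, which form a Lucas
  sequence \<open>u\<close>. Finally, \<open>u\<^bsub>m+1\<^esub> + u\<^sub>m\<close> and \<open>u\<^bsub>m+1\<^esub> - u\<^sub>m\<close> are congruent to \<open>(- c - 2)\<^bsup>(p-1)/2\<^esup>\<close> and
  \<open>(2 - c)\<^bsup>(p-1)/2\<^esup>\<close>, that is, to Legendre symbols by Euler's criterion.\<close>

section \<open>Determinants modulo m and power sums modulo a prime\<close>

lemma det_cong: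
  fixes A B :: "int mat"
  assumes A: "A \<in> carrier_mat n n" and B: "B \<in> carrier_mat n n"
    and AB: "\<And>i j. i < n \<Longrightarrow> j < n \<Longrightarrow> [A $$ (i, j) = B $$ (i, j)] (mod m)"
  shows "[det A = det B] (mod m)"
  unfolding det_def'[OF A] det_def'[OF B]
proof (intro cong_sum cong_mult cong_refl cong_prod)
  fix \<pi> i assume \<pi>: "\<pi> \<in> {\<pi>. \<pi> permutes {0..<n}}" and i: "i \<in> {0..<n}"
  then have "\<pi> i \<in> {0..<n}" by (simp only: mem_Collect_eq permutes_in_image)
  with i show "[A $$ (i, \<pi> i) = B $$ (i, \<pi> i)] (mod m)"
    by (intro AB) simp_all
qed

text \<open>Multiplication by a primitive root \<open>g\<close> permutes the nonzero residues, so
  the sum \<open>S\<close> satisfies S \<equiv> g^k S. As \<open>g\<close> has order p - 1, the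
  factor g^k - 1 is invertible modulo p and \<open>S\<close> vanishes.\<close>

lemma sum_power_cong_0:
  fixes p k :: nat
  assumes p: "prime p" and k: "\<not> (p - 1) dvd k"
  shows "[(\<Sum>x\<in>{1..<p}. int x ^ k) = 0] (mod int p)"
proof -
  have "p > 1" using p prime_gt_1_nat by blast
  \<comment> \<open>The case \<open>p = 2\<close> is excluded by \<open>k\<close>: there p - 1 = 1
    divides every exponent.\<close>
  have "odd p" using p k \<open>p > 1\<close> prime_odd_nat[of p] by (cases "p = 2") auto
  then have "\<exists>q m. p = q ^ m \<and> prime q \<and> odd q \<and> m > 0"
    using p by (intro exI[of _ p] exI[of _ 1]) simp
  then have "p \<in> cyclic_moduli"
    by (auto simp: cyclic_moduli_def)
  then obtain g where g: "residue_primroot p g"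
    using residue_primroot_iff_in_cyclic_moduli[of p] p by (auto simp: prime_gt_0_nat)
  have cop: "coprime p g" and ord: "ord p g = p - 1"
    using g p by (auto simp: residue_primroot_def totient_prime)
  have inj: "inj_on (\<lambda>x. g * x mod p) {1..<p}"
  proof (rule inj_onI)
    fix x y assume xy: "x \<in> {1..<p}" "y \<in> {1..<p}" "g * x mod p = g * y mod p"
    then have "[x = y] (mod p)"
      using cop by (metis cong_def cong_mult_lcancel_nat coprime_commute)
    then show "x = y" using xy by (simp add: cong_def)
  qed
  have "(\<lambda>x. g * x mod p) ` {1..<p} \<subseteq> {1..<p}"
  proof safe
    fix x assume x: "x \<in> {1..<p}"
    have "\<not> p dvd g * x"
      using x cop by (auto simp: coprime_dvd_mult_right_iff dest: dvd_imp_le)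
    then show "g * x mod p \<in> {1..<p}"
      using \<open>p > 1\<close> by (auto simp: dvd_eq_mod_eq_0 Suc_le_eq)
  qed
  then have img: "(\<lambda>x. g * x mod p) ` {1..<p} = {1..<p}"
    using inj by (intro endo_inj_surj) auto
  define S where "S = (\<Sum>x\<in>{1..<p}. int x ^ k)"
  have "S = (\<Sum>x\<in>{1..<p}. int (g * x mod p) ^ k)"
    unfolding S_def by (subst img[symmetric], subst sum.reindex[OF inj]) simp
  also have "[\<dots> = (\<Sum>x\<in>{1..<p}. int (g * x) ^ k)] (mod int p)"
    by (intro cong_sum cong_pow) (simp add: cong_def zmod_int)
  also have "(\<Sum>x\<in>{1..<p}. int (g * x) ^ k) = int g ^ k * S"
    by (simp add: S_def power_mult_distrib sum_distrib_left)
  finally have "int p dvd (int g ^ k - 1) * S"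
    by (simp add: cong_iff_dvd_diff algebra_simps dvd_diff_commute)
  moreover have "\<not> int p dvd int g ^ k - 1"
  proof
    assume "int p dvd int g ^ k - 1"
    then have "[g ^ k = 1] (mod p)"
      by (metis cong_iff_dvd_diff cong_int_iff of_nat_1 of_nat_power)
    then show False using ord_divides ord k by metis
  qed
  ultimately have "int p dvd S"
    using p by (simp add: prime_dvd_mult_iff)
  then show ?thesis by (simp add: S_def cong_0_iff)
qed

lemma sum_power_cong_minus_1:
  fixes p k :: nat
  assumes p: "prime p" and k: "(p - 1) dvd k"
  shows "[(\<Sum>x\<in>{1..<p}. int x ^ k) = - 1] (mod int p)"
proof -
  have "[int x ^ k = 1] (mod int p)" if "x \<in> {1..<p}" for x
  proof -
    obtain q where q: "k = (p - 1) * q" using k by blast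
    have "\<not> p dvd x" using that by (auto dest: dvd_imp_le)
    then have "[(x ^ (p - 1)) ^ q = 1 ^ q] (mod p)"
      using p by (intro cong_pow fermat_theorem)
    then have "[int ((x ^ (p - 1)) ^ q) = int 1] (mod int p)"
      by (subst cong_int_iff) simp
    then show ?thesis by (simp add: q power_mult)
  qed
  then have "[(\<Sum>x\<in>{1..<p}. int x ^ k) = (\<Sum>x\<in>{1..<p}. 1)] (mod int p)"
    by (intro cong_sum)
  also have "(\<Sum>x\<in>{1..<p}. 1) = int p - 1"
    using prime_gt_1_nat[OF p] by simp
  also have "[int p - 1 = - 1] (mod int p)"
    by (simp add: cong_iff_dvd_diff)
  finally show ?thesis .
qed

section \<open>A Lucas sequence and its values modulo p\<close>

text \<open>The coefficients of the power series \<open>1 / (1 + c X + X\<^sup>2)\<close>.\<close>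

fun recip_coeff :: "int \<Rightarrow> nat \<Rightarrow> int" where
  "recip_coeff c 0 = 1"
| "recip_coeff c (Suc 0) = - c"
| "recip_coeff c (Suc (Suc n)) = - c * recip_coeff c (Suc n) - recip_coeff c n"

lemma recip_coeff_uminus: "recip_coeff (- c) n = (- 1) ^ n * recip_coeff c n"
  by (induction c n rule: recip_coeff.induct) (simp_all add: algebra_simps)

text \<open>The addition law of the Chebyshev polynomials U_n, of which these are the values at
  -c/2. With m = n it will turn the entry at p - 1 into a difference of squares.\<close>

lemma recip_coeff_add:
  "recip_coeff c (m + n + 2) =
    recip_coeff c (m + 1) * recip_coeff c (n + 1) - recip_coeff c m * recip_coeff c n"
proof (induction c m rule: recip_coeff.induct)
  case (3 c m)
  have "recip_coeff c (Suc (Suc m) + n + 2) =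
      - c * recip_coeff c (Suc m + n + 2) - recip_coeff c (m + n + 2)"
    by simp
  then show ?case
    unfolding 3 by (simp add: algebra_simps)
qed (simp_all add: algebra_simps)

text \<open>Expansion about c = -2, where the series is 1 / (1 - X)^2 with coefficients n + 1. In
  terms of x = -c - 2 the recurrence reads u(n+2) + u(n) = (x + 2) u(n+1).\<close>

lemma recip_coeff_eq_sum:
  "recip_coeff c n = (\<Sum>j\<le>n. int (n + j + 1 choose (2 * j + 1)) * (- c - 2) ^ j)"
proof (induction c n rule: recip_coeff.induct)
  case (3 c n)
  define x where "x = - c - 2"
  define w where "w = (\<lambda>n j. int (n + j + 1 choose (2 * j + 1)))"
  \<comment> \<open>The binomial coefficients vanish for j > n, so sums for different n can share
    one range.\<close>
  have ext: "(\<Sum>j\<le>n. w n j * x ^ j) = (\<Sum>j\<le>m. w n j * x ^ j)" if "n \<le> m" for n m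
    using that by (intro sum.mono_neutral_left) (auto simp: w_def binomial_eq_0 simp del: binomial_Suc_Suc)
  have w0: "w k 0 = int k + 1" for k by (simp add: w_def)
  \<comment> \<open>The recurrence compared at x^(j+1); it comes down to Pascal's rule.\<close>
  have step: "w (Suc (Suc n)) (Suc j) + w n (Suc j) = w (Suc n) j + 2 * w (Suc n) (Suc j)" for j
  proof -
    have "(Suc (Suc m) choose Suc (Suc k)) + (m choose Suc (Suc k)) =
      (m choose k) + 2 * (Suc m choose Suc (Suc k))" for m k
      by simp
    from this[of "n + j + 2" "2 * j + 1"] show ?thesis
      by (simp add: w_def numeral_2_eq_2 flip: of_nat_add of_nat_mult del: binomial_Suc_Suc)
  qed
  let ?W = "\<lambda>n m. \<Sum>j\<le>m. w n j * x ^ j"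
  have split: "?W k (Suc m) = int k + 1 + x * (\<Sum>j\<le>m. w k (Suc j) * x ^ j)" for k m
    by (simp only: sum.atMost_Suc_shift w0) (simp add: sum_distrib_left mult_ac)
  have "?W (Suc (Suc n)) (Suc (Suc n)) + ?W n (Suc (Suc n)) =
      2 * (int n + 2) + x * (\<Sum>j\<le>Suc n. (w (Suc (Suc n)) (Suc j) + w n (Suc j)) * x ^ j)"
    unfolding split by (simp add: algebra_simps sum.distrib del: sum.atMost_Suc)
  also have "\<dots> = 2 * ?W (Suc n) (Suc (Suc n)) + x * ?W (Suc n) (Suc n)"
    unfolding split[of "Suc n" "Suc n"] step
    by (simp add: algebra_simps sum.distrib sum_distrib_left del: sum.atMost_Suc)
  finally have "?W (Suc (Suc n)) (Suc (Suc n)) = (x + 2) * ?W (Suc n) (Suc n) - ?W n n"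
    using ext[of n "Suc (Suc n)"] ext[of "Suc n" "Suc (Suc n)"]
    by (simp add: algebra_simps del: sum.atMost_Suc)
  with 3 show ?case
    by (simp add: w_def x_def del: sum.atMost_Suc)
qed (simp_all add: numeral_2_eq_2 numeral_3_eq_3)

text \<open>For \<open>p = 2 * n + 1\<close> this makes all but the top coefficient in the expansion of
  \<open>recip_coeff c n + recip_coeff c (n - 1)\<close> in powers of \<open>- c - 2\<close> divisible by \<open>p\<close>.\<close>

lemma binomial_add_absorb:
  "(2 * j + 1) * ((n + j + 1 choose (2 * j + 1)) + (n + j choose (2 * j + 1))) =
    (2 * n + 1) * (n + j choose (2 * j))"
proof -
  have "Suc (n + j) * (n + j choose (2 * j)) = (Suc (n + j) choose Suc (2 * j)) * Suc (2 * j)"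
    by (rule Suc_times_binomial_eq)
  moreover have "(Suc (n + j) choose Suc (2 * j)) = (n + j choose (2 * j)) + (n + j choose Suc (2 * j))"
    by simp
  ultimately show ?thesis
    by (simp add: algebra_simps del: binomial_Suc_Suc)
qed

text \<open>Since \<open>Suc m\<close> is (p - 1) / 2, Euler's criterion will identify the
  right-hand side with the Legendre symbol of -c - 2.\<close>

lemma recip_coeff_add_pred_cong:
  fixes p m :: nat
  assumes p: "prime p" and pm: "p = 2 * m + 3"
  shows "[recip_coeff c (Suc m) + recip_coeff c m = (- c - 2) ^ Suc m] (mod int p)"
proof -
  define x where "x = - c - 2"
  define w where "w = (\<lambda>j. (Suc m + j + 1 choose (2 * j + 1)) + (Suc m + j choose (2 * j + 1)))"
  have "recip_coeff c m = (\<Sum>j\<le>Suc m. int (m + j + 1 choose (2 * j + 1)) * x ^ j)"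
    unfolding recip_coeff_eq_sum x_def by (intro sum.mono_neutral_left) (auto simp: binomial_eq_0 simp del: binomial_Suc_Suc)
  then have "recip_coeff c (Suc m) + recip_coeff c m = (\<Sum>j\<le>Suc m. int (w j) * x ^ j)"
    unfolding recip_coeff_eq_sum[of c "Suc m"]
    by (simp add: w_def x_def algebra_simps flip: sum.distrib del: sum.atMost_Suc binomial_Suc_Suc)
  also have "[\<dots> = (\<Sum>j\<le>Suc m. if j = Suc m then x ^ j else 0)] (mod int p)"
  proof (intro cong_sum)
    fix j assume j: "j \<in> {..Suc m}"
    show "[int (w j) * x ^ j = (if j = Suc m then x ^ j else 0)] (mod int p)"
    proof (cases "j = Suc m")
      case True
      then show ?thesis by (simp add: w_def mult_2 binomial_eq_0 del: binomial_Suc_Suc)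
    next
      case False
      \<comment> \<open>Absorption brings out the factor p, and j \<le> m keeps 2 j + 1 below p,
        hence prime to it.\<close>
      have "(2 * j + 1) * w j = p * (Suc m + j choose (2 * j))"
        unfolding w_def binomial_add_absorb pm by (simp add: algebra_simps del: binomial_Suc_Suc)
      then have "p dvd (2 * j + 1) * w j" by simp
      moreover have "\<not> p dvd 2 * j + 1"
        using j False pm by (auto dest: dvd_imp_le)
      ultimately have "p dvd w j"
        using p prime_dvd_multD by blast
      then show ?thesis using False by (simp add: cong_0_iff)
    qed
  qed
  also have "(\<Sum>j\<le>Suc m. if j = Suc m then x ^ j else 0) = x ^ Suc m"
    by (subst sum.delta) auto
  finally show ?thesis by (simp add: x_def)
qed

text \<open>The previous congruence at \<open>- c\<close>: the substitution X -> -X alternates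
  signs, which turns the sum of two neighbours into a difference.\<close>

lemma recip_coeff_diff_pred_cong:
  fixes p m :: nat
  assumes "prime p" "p = 2 * m + 3"
  shows "[recip_coeff c (Suc m) - recip_coeff c m = (2 - c) ^ Suc m] (mod int p)"
proof -
  have "[(- 1) ^ Suc m * (recip_coeff (- c) (Suc m) + recip_coeff (- c) m)
      = (- 1) ^ Suc m * (- (- c) - 2) ^ Suc m] (mod int p)"
    by (intro cong_mult cong_refl recip_coeff_add_pred_cong assms)
  also have "(- 1) ^ Suc m * (- (- c) - 2) ^ Suc m = (2 - c) ^ Suc m"
    unfolding power_mult_distrib[symmetric] by simp
  also have "(- 1) ^ Suc m * (recip_coeff (- c) (Suc m) + recip_coeff (- c) m)
      = recip_coeff c (Suc m) - recip_coeff c m"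
    by (simp add: recip_coeff_uminus algebra_simps flip: power_add mult.assoc)
  finally show ?thesis .
qed

section \<open>The power series inverse and coefficients of trinomial powers\<close>

lemma fps_trinomial_mult_recip:
  "fps_of_poly [:1, c, 1:] * Abs_fps (recip_coeff c) = 1"
proof -
  have G: "fps_of_poly [:1, c, 1:] = 1 + fps_const c * fps_X + fps_X ^ 2"
    by (simp add: fps_of_poly_pCons power2_eq_square algebra_simps)
  show ?thesis
  proof (rule fps_ext)
    fix n
    show "fps_nth (fps_of_poly [:1, c, 1:] * Abs_fps (recip_coeff c)) n = fps_nth 1 n"
      unfolding G
      by (cases "(c, n)" rule: recip_coeff.cases)
        (simp_all add: distrib_right mult.assoc fps_X_power_mult_nth)
  qed
qed

text \<open>Differentiating \<open>G * h = 1\<close> gives h' = -G' h^2, and G'^2 = c^2 - 4 + 4 G.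
  Hence (G' h)' = 2 h - G'^2 h^2 = -2 h - (c^2 - 4) h^2, of which the n-th coefficient is
  taken.\<close>

lemma discriminant_mult_recip_square:
  "(c\<^sup>2 - 4) * fps_nth ((Abs_fps (recip_coeff c))\<^sup>2) n =
    - 2 * recip_coeff c n
    - int (n + 1) * (c * recip_coeff c (n + 1) + 2 * recip_coeff c n)"
proof -
  define G where "G = fps_of_poly [:1, c, 1:]"
  define h where "h = Abs_fps (recip_coeff c)"
  define D where "D = fps_const c + 2 * fps_X"
  have Gh: "G * h = 1" unfolding G_def h_def by (rule fps_trinomial_mult_recip)
  have G: "G = 1 + fps_const c * fps_X + fps_X ^ 2"
    by (simp add: G_def fps_of_poly_pCons power2_eq_square algebra_simps)
  have dG: "fps_deriv G = D"
    by (simp add: G D_def power2_eq_square)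
  have D2: "D\<^sup>2 = fps_const (c\<^sup>2 - 4) + 4 * G"
    by (simp add: D_def G power2_eq_square algebra_simps numeral_fps_const flip: fps_const_mult fps_const_sub)
  have "fps_deriv (G * h) = 0" unfolding Gh by simp
  then have "D * h + G * fps_deriv h = 0" by (simp add: dG algebra_simps)
  then have "h * (D * h + G * fps_deriv h) = 0" by simp
  then have "D * h\<^sup>2 + (G * h) * fps_deriv h = 0" by (simp add: algebra_simps power2_eq_square)
  then have dh: "fps_deriv h = - (D * h\<^sup>2)" by (simp add: Gh eq_neg_iff_add_eq_0 add.commute)
  have dD: "fps_deriv D = 2" by (simp add: D_def)
  have "fps_deriv (D * h) = 2 * h - D\<^sup>2 * h\<^sup>2"
    by (simp add: dh dD algebra_simps power2_eq_square)
  also have "D\<^sup>2 * h\<^sup>2 = fps_const (c\<^sup>2 - 4) * h\<^sup>2 + 4 * (G * h) * h"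
    unfolding D2 by (simp add: algebra_simps power2_eq_square)
  finally have "fps_const (c\<^sup>2 - 4) * h\<^sup>2 = - 2 * h - fps_deriv (D * h)"
    by (simp add: Gh)
  then have "fps_nth (fps_const (c\<^sup>2 - 4) * h\<^sup>2) n = fps_nth (- 2 * h - fps_deriv (D * h)) n"
    by simp
  then show ?thesis
    by (cases n) (simp_all add: h_def D_def distrib_right mult.assoc numeral_fps_const algebra_simps flip: fps_const_neg)
qed

text \<open>In the binomial expansion of 1 + X (c + X) only the terms k = 0 and k = p survive modulo
  p, and the latter is divisible by X^p, hence invisible below degree p.\<close>

lemma coeff_trinomial_power_prime_cong:
  assumes p: "prime p" and n: "n < p"
  shows "[poly.coeff ([:1, c, 1:] ^ p) n = (if n = 0 then 1 else 0)] (mod int p)"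
proof -
  define a :: "int poly" where "a = Polynomial.monom 1 1 * [:c, 1:]"
  have "[:1, c, 1:] = a + 1"
    by (simp add: a_def monom_altdef one_pCons)
  then have "poly.coeff ([:1, c, 1:] ^ p) n = (\<Sum>k\<le>p. int (p choose k) * poly.coeff (a ^ k) n)"
    by (simp add: binomial_ring coeff_sum of_nat_poly)
  also have "[\<dots> = (\<Sum>k\<le>p. if k = 0 then if n = 0 then 1 else 0 else 0)] (mod int p)"
  proof (intro cong_sum)
    fix k assume "k \<in> {..p}"
    then consider "k = 0" | "k = p" | "0 < k" "k < p" by force
    then show "[int (p choose k) * poly.coeff (a ^ k) n = (if k = 0 then if n = 0 then 1 else 0 else 0)] (mod int p)"
    proof cases
      case 2
      have "a ^ k = Polynomial.monom 1 k * [:c, 1:] ^ k"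
        unfolding a_def power_mult_distrib by (simp only: Polynomial.monom_power power_one mult_1)
      then show ?thesis using n 2
        by (simp add: Polynomial.coeff_monom_mult)
    next
      case 3
      then have "p dvd p choose k" using p by (intro dvd_choose_prime) auto
      then show ?thesis using 3 by (simp add: cong_0_iff)
    qed simp
  qed
  also have "(\<Sum>k\<le>p. if k = 0 then if n = 0 then 1 else 0 else 0) = (if n = 0 then 1 else (0 :: int))"
    by (subst sum.delta) auto
  finally show ?thesis .
qed

text \<open>As power series g^(p-2) = g^p h^2, and modulo p the factor g^p is 1 up to terms of
  degree at least p.\<close>

lemma coeff_trinomial_power_cong_recip_square:
  assumes p: "prime p" and n: "n < p"
  shows "[poly.coeff ([:1, c, 1:] ^ (p - 2)) n = fps_nth ((Abs_fps (recip_coeff c))\<^sup>2) n] (mod int p)"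
proof -
  define g where "g = [:1, c, 1:]"
  define h where "h = Abs_fps (recip_coeff c)"
  have "p \<ge> 2" using p prime_ge_2_nat by blast
  then have "g ^ p = g ^ (p - 2 + 2)" by (simp only: le_add_diff_inverse2)
  then have "g ^ p = g ^ (p - 2) * g\<^sup>2" by (simp only: power_add)
  moreover have "(fps_of_poly g * h) ^ 2 = 1"
    unfolding g_def h_def fps_trinomial_mult_recip by simp
  ultimately have "fps_of_poly (g ^ (p - 2)) = fps_of_poly (g ^ p) * h\<^sup>2"
    by (simp add: fps_of_poly_mult fps_of_poly_power power_mult_distrib mult.assoc)
  then have "poly.coeff (g ^ (p - 2)) n = fps_nth (fps_of_poly (g ^ p) * h\<^sup>2) n"
    by (metis fps_of_poly_nth)
  also have "\<dots> = (\<Sum>i=0..n. poly.coeff (g ^ p) i * fps_nth (h\<^sup>2) (n - i))"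
    by (simp add: fps_mult_nth)
  also have "[\<dots> = (\<Sum>i=0..n. (if i = 0 then 1 else 0) * fps_nth (h\<^sup>2) (n - i))] (mod int p)"
    unfolding g_def using n
    by (intro cong_sum cong_mult cong_refl coeff_trinomial_power_prime_cong p) simp
  also have "(\<Sum>i=0..n. (if i = 0 then 1 else 0) * fps_nth (h\<^sup>2) (n - i)) = fps_nth (h\<^sup>2) n"
    by (simp add: if_distrib[of "\<lambda>x. x * _"] cong: if_cong)
  finally show ?thesis by (simp add: g_def h_def)
qed

lemma coeff_trinomial_power_symmetric:
  fixes c :: int
  assumes "n \<le> 2 * k"
  shows "poly.coeff ([:1, c, 1:] ^ k) (2 * k - n) = poly.coeff ([:1, c, 1:] ^ k) n"
proof -
  have "reflect_poly [:1, c, 1:] = [:1, c, 1:]"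
    by (simp add: reflect_poly_pCons)
  then have "reflect_poly ([:1, c, 1:] ^ k) = [:1, c, 1:] ^ k"
    by (simp add: reflect_poly_power)
  moreover have "degree ([:1, c, 1:] ^ k) = 2 * k"
    by (simp add: degree_power_eq)
  ultimately show ?thesis
    using assms by (metis coeff_reflect_poly not_less)
qed

section \<open>Diagonalisation of the matrix modulo p\<close>

lemma det_mat_diag: "det (mat_diag n f) = (\<Prod>i<n. f i :: int)"
proof -
  have "upper_triangular (mat_diag n f)"
    by (auto simp: upper_triangular_def mat_diag_def)
  moreover have "diag_mat (mat_diag n f) = map f [0..<n]"
    by (simp add: diag_mat_def mat_diag_def cong: map_cong)
  ultimately show ?thesis
    by (simp add: det_upper_triangular[of _ n] prod.list_conv_set_nth lessThan_atLeast0)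
qed

text \<open>The coefficients of \<open>(1 + c X + X\<^sup>2)\<^bsup>p-2\<^esup>\<close> modulo \<open>X\<^bsup>p-1\<^esup> - 1\<close>; its degree is less than
  \<open>2 (p - 1)\<close>, so two summands suffice.\<close>

definition folded_coeff :: "nat \<Rightarrow> int \<Rightarrow> nat \<Rightarrow> int" where
  "folded_coeff p c k =
    poly.coeff ([:1, c, 1:] ^ (p - 2)) k + poly.coeff ([:1, c, 1:] ^ (p - 2)) (k + (p - 1))"

text \<open>With t = x y^(p-2), which represents x / y by Fermat, the quadratic form is y^2 g(t),
  and (y^2)^(p-1) \<equiv> 1 leaves the value of g^(p-2) at t. Folding by t^(p-1) \<equiv> 1 gives a
  sum whose terms separate x from y, so it can be read as an entry of a product with a diagonal
  middle factor.\<close>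

lemma trinomial_factor_cong:
  fixes p :: nat and x y :: int
  assumes p: "prime p" and x: "\<not> int p dvd x" and y: "\<not> int p dvd y"
  shows "[(x\<^sup>2 + c * x * y + y\<^sup>2) ^ (p - 2) * y\<^sup>2 =
    (\<Sum>k<p - 1. x ^ k * folded_coeff p c k * y ^ ((p - 2) * k))] (mod int p)"
proof -
  define P where "P = [:1, c, 1:] ^ (p - 2)"
  define t where "t = x * y ^ (p - 2)"
  have "p \<ge> 2" using p prime_ge_2_nat by blast
  have fermat: "[z ^ (p - 1) = 1] (mod int p)" if "\<not> int p dvd z" for z
  proof -
    have "[nat (z mod int p) ^ (p - 1) = 1] (mod p)"
    proof (rule fermat_theorem[OF p])
      have "int (nat (z mod int p)) = z mod int p"
        using \<open>p \<ge> 2\<close> by simp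
      then show "\<not> p dvd nat (z mod int p)"
        using that by (metis dvd_mod_iff dvd_refl int_dvd_int_iff)
    qed
    then have "[int (nat (z mod int p)) ^ (p - 1) = 1] (mod int p)"
      by (metis cong_int_iff of_nat_1 of_nat_power)
    then have "[(z mod int p) ^ (p - 1) = 1] (mod int p)"
      using \<open>p \<ge> 2\<close> by simp
    then show ?thesis by (simp add: cong_def power_mod)
  qed
  have yt: "[y * t = x] (mod int p)"
  proof -
    have "y * t = x * y ^ (p - 1)"
      using \<open>p \<ge> 2\<close> by (simp add: t_def Suc_diff_Suc numeral_2_eq_2 flip: power_Suc)
    also have "[\<dots> = x * 1] (mod int p)"
      by (intro cong_mult cong_refl fermat y)
    finally show ?thesis by simp
  qed
  have t: "\<not> int p dvd t"
    using x y p by (auto simp: t_def prime_dvd_mult_iff dest: prime_dvd_power[rotated])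
  have yy: "[(y\<^sup>2) ^ (p - 2) * y\<^sup>2 = 1] (mod int p)"
  proof -
    have "(y\<^sup>2) ^ (p - 2) * y\<^sup>2 = (y\<^sup>2) ^ (p - 2 + 1)" by (simp only: power_add power_one_right)
    also have "p - 2 + 1 = p - 1" using \<open>p \<ge> 2\<close> by simp
    also have "(y\<^sup>2) ^ (p - 1) = (y ^ (p - 1))\<^sup>2" by (simp flip: power_mult add: mult.commute)
    also have "[\<dots> = 1\<^sup>2] (mod int p)" by (intro cong_pow fermat y)
    finally show ?thesis by simp
  qed
  have "[x\<^sup>2 + c * x * y + y\<^sup>2 = (y * t)\<^sup>2 + c * (y * t) * y + y\<^sup>2] (mod int p)"
    by (intro cong_add cong_mult cong_pow cong_refl cong_sym[OF yt])
  also have "(y * t)\<^sup>2 + c * (y * t) * y + y\<^sup>2 = y\<^sup>2 * poly [:1, c, 1:] t"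
    by (simp add: algebra_simps power2_eq_square)
  finally have "[(x\<^sup>2 + c * x * y + y\<^sup>2) ^ (p - 2) * y\<^sup>2 = (y\<^sup>2 * poly [:1, c, 1:] t) ^ (p - 2) * y\<^sup>2] (mod int p)"
    by (intro cong_mult cong_pow cong_refl)
  also have "(y\<^sup>2 * poly [:1, c, 1:] t) ^ (p - 2) * y\<^sup>2 = ((y\<^sup>2) ^ (p - 2) * y\<^sup>2) * poly P t"
    by (simp only: P_def poly_power power_mult_distrib mult_ac)
  also have "[\<dots> = 1 * poly P t] (mod int p)"
    by (intro cong_mult cong_refl yy)
  also have "1 * poly P t = (\<Sum>k\<le>degree P. poly.coeff P k * t ^ k)"
    by (simp add: poly_altdef)
  also have "\<dots> = (\<Sum>k<(p - 1) + (p - 1). poly.coeff P k * t ^ k)"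
  proof -
    have "degree P \<le> 2 * (p - 2)"
      using degree_power_le[of "[:1, c, 1:]" "p - 2"] by (simp add: P_def)
    then have "{..degree P} \<subseteq> {..<(p - 1) + (p - 1)}" using \<open>p \<ge> 2\<close> by auto
    then show ?thesis
      by (intro sum.mono_neutral_left) (auto simp: coeff_eq_0)
  qed
  also have "\<dots> = (\<Sum>k<p - 1. poly.coeff P k * t ^ k) + (\<Sum>k<p - 1. poly.coeff P (k + (p - 1)) * t ^ (k + (p - 1)))"
  proof -
    have "(\<Sum>k<n + n. f k) = (\<Sum>k<n. f k) + (\<Sum>k<n. f (k + n))" for f :: "nat \<Rightarrow> int" and n
      using sum.atLeastLessThan_concat[of 0 n "n + n" f] sum.shift_bounds_nat_ivl[of f 0 n n]
      by (simp add: lessThan_atLeast0)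
    then show ?thesis .
  qed
  also have "[\<dots> = (\<Sum>k<p - 1. poly.coeff P k * t ^ k) + (\<Sum>k<p - 1. poly.coeff P (k + (p - 1)) * (t ^ k * 1))] (mod int p)"
    unfolding power_add
    by (intro cong_add cong_sum cong_mult cong_refl fermat t)
  also have "(\<Sum>k<p - 1. poly.coeff P k * t ^ k) + (\<Sum>k<p - 1. poly.coeff P (k + (p - 1)) * (t ^ k * 1)) =
      (\<Sum>k<p - 1. x ^ k * folded_coeff p c k * y ^ ((p - 2) * k))"
    unfolding power_mult[of y]
    by (simp add: folded_coeff_def t_def P_def power_mult_distrib
        distrib_left distrib_right sum.distrib mult_ac)
  finally show ?thesis .
qed

text \<open>Modulo p, the previous lemma factors \<open>D_mat p c * F\<close> as
  \<open>X * A * Y\<close> with \<open>A\<close> diagonal. The other determinants are 1: that of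
  \<open>F\<close> by Wilson's theorem, and that of \<open>Y * X\<close> because the power sums make
  it minus the identity, of even size.\<close>

lemma det_D_mat_cong_prod:
  fixes p :: nat
  assumes p: "prime p" and odd: "odd p"
  shows "[det (D_mat p c) = (\<Prod>k<p - 1. folded_coeff p c k)] (mod int p)"
proof -
  define n where "n = p - 1"
  have "p \<ge> 2" using p prime_ge_2_nat by blast
  define X where "X = mat n n (\<lambda>(i, k). int (i + 1) ^ k)"
  define Y where "Y = mat n n (\<lambda>(k, j). int (j + 1) ^ ((p - 2) * k))"
  define A where "A = mat_diag n (folded_coeff p c)"
  define F where "F = mat_diag n (\<lambda>j. (int (j + 1))\<^sup>2)"
  note defs = X_def Y_def A_def F_def
  have X: "X \<in> carrier_mat n n" and Y: "Y \<in> carrier_mat n n" and A: "A \<in> carrier_mat n n"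
    and F: "F \<in> carrier_mat n n"
    by (simp_all add: defs)
  have D: "D_mat p c \<in> carrier_mat n n" by (simp add: D_mat_def n_def)
  have ndvd: "\<not> int p dvd int (i + 1)" if "i < n" for i
    using that by (auto simp: n_def simp del: of_nat_Suc of_nat_add dest!: dvd_imp_le)

  have "[det (D_mat p c * F) = det (X * A * Y)] (mod int p)"
  proof (rule det_cong)
    fix i j assume ij: "i < n" "j < n"
    have "(D_mat p c * F) $$ (i, j) =
        ((int (i + 1))\<^sup>2 + c * int (i + 1) * int (j + 1) + (int (j + 1))\<^sup>2) ^ (p - 2) * (int (j + 1))\<^sup>2"
      unfolding F_def mat_diag_mult_right[OF D] using ij by (simp add: D_mat_def n_def)
    also have "[\<dots> = (\<Sum>k<p - 1. int (i + 1) ^ k * folded_coeff p c k * int (j + 1) ^ ((p - 2) * k))] (mod int p)"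
      by (intro trinomial_factor_cong p ndvd ij)
    also have "(\<Sum>k<p - 1. int (i + 1) ^ k * folded_coeff p c k * int (j + 1) ^ ((p - 2) * k)) =
        (X * A * Y) $$ (i, j)"
      unfolding A_def mat_diag_mult_right[OF X] using ij
      by (simp add: X_def Y_def scalar_prod_def lessThan_atLeast0 n_def)
    finally show "[(D_mat p c * F) $$ (i, j) = (X * A * Y) $$ (i, j)] (mod int p)" .
  qed (use D F X A Y in auto)
  moreover have "det (D_mat p c * F) = det (D_mat p c) * det F"
    by (rule det_mult[OF D F])
  \<comment> \<open>Commuting the factors lets the inner summation run over the residues, so that
    power sums take the place of Vandermonde determinants.\<close>
  moreover have "det (X * A * Y) = det A * det (Y * X)"
    using X A Y by (simp add: det_mult[of _ n])
  ultimately have main: "[det (D_mat p c) * det F = det A * det (Y * X)] (mod int p)"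
    by simp

  have "[det (Y * X) = det (mat_diag n (\<lambda>_. - 1))] (mod int p)"
  proof (rule det_cong)
    fix k l assume kl: "k < n" "l < n"
    have "(Y * X) $$ (k, l) = (\<Sum>j<n. int (Suc j) ^ ((p - 2) * k + l))"
      using kl by (simp add: X_def Y_def scalar_prod_def lessThan_atLeast0 power_add)
    also have "\<dots> = (\<Sum>x\<in>{1..<p}. int x ^ ((p - 2) * k + l))"
      by (rule sum.reindex_bij_witness[of _ "\<lambda>x. x - 1" Suc]) (auto simp: n_def)
    finally have YX: "(Y * X) $$ (k, l) = (\<Sum>x\<in>{1..<p}. int x ^ ((p - 2) * k + l))" .
    \<comment> \<open>Modulo p - 1 the exponent is l - k, and both indices are less than p -
      1.\<close>
    have dvd_iff: "(p - 1) dvd (p - 2) * k + l \<longleftrightarrow> k = l"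
    proof -
      have "int ((p - 2) * k + l) = int (p - 1) * int k + (int l - int k)"
      proof -
        have "p - 1 = Suc (p - 2)" using \<open>p \<ge> 2\<close> by simp
        then show ?thesis by (simp add: distrib_right) (simp add: algebra_simps)
      qed
      then have "(p - 1) dvd (p - 2) * k + l \<longleftrightarrow> int (p - 1) dvd int l - int k"
        by (metis dvd_add_right_iff dvd_triv_left int_dvd_int_iff)
      also have "\<dots> \<longleftrightarrow> [int l = int k] (mod int (p - 1))"
        by (simp add: cong_iff_dvd_diff)
      also have "\<dots> \<longleftrightarrow> k = l"
        using kl by (auto simp: cong_int_iff n_def cong_def)
      finally show ?thesis .
    qed
    show "[(Y * X) $$ (k, l) = mat_diag n (\<lambda>_. - 1) $$ (k, l)] (mod int p)"
    proof (cases "k = l")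
      case True
      then show ?thesis
        unfolding YX using sum_power_cong_minus_1[OF p, of "(p - 2) * k + l"] dvd_iff kl
        by (simp add: mat_diag_def)
    next
      case False
      then show ?thesis
        unfolding YX using sum_power_cong_0[OF p, of "(p - 2) * k + l"] dvd_iff kl
        by (simp add: mat_diag_def)
    qed
  qed (use X Y in auto)
  moreover have "det (mat_diag n (\<lambda>_. - 1 :: int)) = 1"
    using odd by (simp add: det_mat_diag n_def)
  ultimately have YX: "[det (Y * X) = 1] (mod int p)" by simp

  have "det F = (fact (p - 1))\<^sup>2"
    by (simp add: F_def det_mat_diag prod_power_distrib fact_prod_Suc n_def lessThan_atLeast0)
  moreover have "[(fact (p - 1) :: int)\<^sup>2 = (- 1)\<^sup>2] (mod int p)"
    using wilson_theorem[OF p] by (intro cong_pow)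
  ultimately have F1: "[det F = 1] (mod int p)" by simp

  have "[det (D_mat p c) * 1 = det (D_mat p c) * det F] (mod int p)"
    by (intro cong_mult cong_refl cong_sym[OF F1])
  also note main
  also have "[det A * det (Y * X) = det A * 1] (mod int p)"
    by (intro cong_mult cong_refl YX)
  finally show ?thesis
    by (simp add: A_def det_mat_diag n_def)
qed

section \<open>Pairing of the diagonal entries\<close>

lemma prod_symmetric:
  fixes f :: "nat \<Rightarrow> 'a :: comm_monoid_mult"
  assumes "\<And>k. k \<le> 2 * m \<Longrightarrow> f (2 * m - k) = f k"
  shows "(\<Prod>k<2 * m + 1. f k) = f m * (\<Prod>k<m. f k)\<^sup>2"
proof -
  have "(\<Prod>k<2 * m + 1. f k) = (\<Prod>k\<in>insert m ({..<m} \<union> {m<..2 * m}). f k)"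
    by (intro prod.cong) auto
  also have "\<dots> = f m * ((\<Prod>k<m. f k) * (\<Prod>k\<in>{m<..2 * m}. f k))"
    by (subst prod.insert, simp, simp, subst prod.union_disjoint) auto
  also have "(\<Prod>k\<in>{m<..2 * m}. f k) = (\<Prod>k<m. f k)"
    by (rule prod.reindex_bij_witness[of _ "\<lambda>k. 2 * m - k" "\<lambda>k. 2 * m - k"]) (auto simp: assms)
  finally show ?thesis by (simp add: power2_eq_square)
qed

text \<open>The symmetry of the coefficients b sends k + (p - 1) to 2m - k, so the folded
  coefficient is a(k) = b(k) + b(2m - k) for k \<le> 2m. These indices pair up except for the fixed
  point m, where a(m) = 2 b(m); the index p - 2 = 2m + 1 is left over.\<close>

lemma det_D_mat_cong_coeffs:
  fixes p m :: nat
  assumes p: "prime p" and pm: "p = 2 * m + 3"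
  obtains S where "[det (D_mat p c) =
    poly.coeff ([:1, c, 1:] ^ (p - 2)) (p - 2) * (2 * poly.coeff ([:1, c, 1:] ^ (p - 2)) m) * S\<^sup>2] (mod int p)"
proof -
  define b where "b = poly.coeff ([:1, c, 1:] ^ (p - 2))"
  define a where "a = folded_coeff p c"
  have sym: "b (4 * m + 2 - n) = b n" if "n \<le> 4 * m + 2" for n
    using coeff_trinomial_power_symmetric[of n "p - 2" c] that by (simp add: b_def pm)
  \<comment> \<open>At k = p - 2 the second summand has index 2p - 3, one above the degree 2p -
    4.\<close>
  have "degree ([:1, c, 1:] ^ (p - 2)) < 4 * m + 3"
    using degree_power_le[of "[:1, c, 1:]" "p - 2"] by (simp add: pm)
  then have "b (4 * m + 3) = 0"
    unfolding b_def by (rule coeff_eq_0)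
  moreover have "2 * m + 1 = p - 2" "p - 2 + (p - 1) = 4 * m + 3"
    by (simp_all add: pm)
  ultimately have last: "a (2 * m + 1) = b (p - 2)"
    by (simp only: a_def folded_coeff_def b_def add_0_right)
  have mid: "a m = 2 * b m"
    using sym[of m] by (simp add: a_def folded_coeff_def flip: b_def, simp add: pm algebra_simps)
  have "a (2 * m - k) = a k" if "k \<le> 2 * m" for k
    using sym[of k] sym[of "2 * m - k"] that by (simp add: a_def folded_coeff_def flip: b_def, simp add: pm algebra_simps)
  then have "(\<Prod>k<2 * m + 1. a k) = a m * (\<Prod>k<m. a k)\<^sup>2"
    by (rule prod_symmetric)
  moreover have "(\<Prod>k<p - 1. a k) = a (2 * m + 1) * (\<Prod>k<2 * m + 1. a k)"
    by (simp add: pm mult.commute)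
  ultimately have "(\<Prod>k<p - 1. a k) = b (p - 2) * (2 * b m) * (\<Prod>k<m. a k)\<^sup>2"
    by (simp only: last mid mult.assoc)
  then show thesis
    using det_D_mat_cong_prod[OF p, of c] pm that[of "\<Prod>k<m. a k"]
    by (simp add: a_def b_def)
qed

section \<open>The case of c congruent to 2 or -2\<close>

lemma det_D_mat_cong:
  assumes "[c = c'] (mod int p)"
  shows "[det (D_mat p c) = det (D_mat p c')] (mod int p)"
proof (rule det_cong)
  fix i j assume "i < p - 1" "j < p - 1"
  then show "[D_mat p c $$ (i, j) = D_mat p c' $$ (i, j)] (mod int p)"
    unfolding D_mat_def using assms
    by (auto intro!: cong_pow cong_add cong_mult)
qed (auto simp: D_mat_def)

lemma coeff_one_plus_linear_power:
  fixes s :: "'a :: comm_ring_1"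
  shows "poly.coeff ([:1, s:] ^ n) k = of_nat (n choose k) * s ^ k"
proof -
  have "[:1, s:] = Polynomial.monom s 1 + 1"
    by (simp add: monom_altdef one_pCons)
  then have "poly.coeff ([:1, s:] ^ n) k = (\<Sum>i\<le>n. of_nat (n choose i) * (if i = k then s ^ i else 0))"
    by (simp add: binomial_ring coeff_sum of_nat_poly Polynomial.monom_power)
  also have "\<dots> = (\<Sum>i\<le>n. if i = k then of_nat (n choose i) * s ^ i else 0)"
    by (intro sum.cong) auto
  also have "\<dots> = of_nat (n choose k) * s ^ k"
    by (auto simp: binomial_eq_0)
  finally show ?thesis .
qed

lemma prime_dvd_central_binomial:
  fixes p q :: nat
  assumes p: "prime p" and "q < p" and "p \<le> 2 * q"
  shows "p dvd (2 * q choose q)"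
proof -
  have "fact q * fact q * (2 * q choose q) = (fact (2 * q) :: nat)"
    using binomial_fact_lemma[of q "2 * q"] by simp
  moreover have "p dvd fact (2 * q)" and "\<not> p dvd fact q"
    using assms by (auto simp: prime_dvd_fact_iff)
  ultimately show ?thesis
    using prime_dvd_multD[OF p, of "fact q * fact q" "2 * q choose q"] prime_dvd_multD[OF p, of "fact q" "fact q"]
    by auto
qed

text \<open>Here \<open>s\<close> is a sign and the trinomial is (1 + s X)^2, so the leftover
  coefficient is up to sign a central binomial coefficient, which p divides once p \<le> 2 (p - 2).
  This fails for p = 3, and so does the claim: for c = 2 the determinant is 4 * 16 - 9 * 9 =
  -17.\<close>

lemma det_D_mat_cong_0:
  fixes p :: nat and s :: int
  assumes p: "prime p" and odd: "odd p" and "p \<noteq> 3" and s: "s\<^sup>2 = 1"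
    and c: "[c = 2 * s] (mod int p)"
  shows "[det (D_mat p c) = 0] (mod int p)"
proof -
  have "p > 3" using assms prime_ge_2_nat[OF p] by (cases "p = 2") auto
  from odd obtain k where "p = 2 * k + 1" by (elim oddE)
  with \<open>p > 3\<close> have pm: "p = 2 * (k - 1) + 3" by simp
  obtain S where S: "[det (D_mat p (2 * s)) = poly.coeff ([:1, 2 * s, 1:] ^ (p - 2)) (p - 2) *
      (2 * poly.coeff ([:1, 2 * s, 1:] ^ (p - 2)) (k - 1)) * S\<^sup>2] (mod int p)"
    by (rule det_D_mat_cong_coeffs[OF p pm])
  have "[:1, 2 * s, 1:] = [:1, s:] ^ 2"
    using s by (simp add: power2_eq_square)
  then have "poly.coeff ([:1, 2 * s, 1:] ^ (p - 2)) (p - 2) = int (2 * (p - 2) choose (p - 2)) * s ^ (p - 2)"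
    by (simp only: coeff_one_plus_linear_power flip: power_mult)
  moreover have "p dvd (2 * (p - 2) choose (p - 2))"
    using \<open>p > 3\<close> by (intro prime_dvd_central_binomial p) auto
  ultimately have "[poly.coeff ([:1, 2 * s, 1:] ^ (p - 2)) (p - 2) = 0] (mod int p)"
    by (simp add: cong_0_iff)
  then have "[poly.coeff ([:1, 2 * s, 1:] ^ (p - 2)) (p - 2) *
      (2 * poly.coeff ([:1, 2 * s, 1:] ^ (p - 2)) (k - 1)) * S\<^sup>2 =
      0 * (2 * poly.coeff ([:1, 2 * s, 1:] ^ (p - 2)) (k - 1)) * S\<^sup>2] (mod int p)"
    by (intro cong_mult cong_refl)
  with S have "[det (D_mat p (2 * s)) = 0] (mod int p)"
    by (simp add: cong_def)
  with det_D_mat_cong[OF c] show ?thesis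
    by (rule cong_trans)
qed

section \<open>The two unpaired coefficients in terms of the Lucas sequence\<close>

text \<open>At n = p - 2 the factor n + 1 is -1 modulo p, so the terms with u(p-2) cancel. The
  addition law then splits the index p - 1 = m + m + 2.\<close>

lemma discriminant_mult_coeff_central_cong:
  fixes p m :: nat
  assumes p: "prime p" and pm: "p = 2 * m + 3"
  shows "[(c\<^sup>2 - 4) * poly.coeff ([:1, c, 1:] ^ (p - 2)) (p - 2) =
    c * ((recip_coeff c (Suc m))\<^sup>2 - (recip_coeff c m)\<^sup>2)] (mod int p)"
proof -
  let ?u = "recip_coeff c"
  have "[(c\<^sup>2 - 4) * poly.coeff ([:1, c, 1:] ^ (p - 2)) (p - 2) =
      (c\<^sup>2 - 4) * fps_nth ((Abs_fps ?u)\<^sup>2) (p - 2)] (mod int p)"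
    using pm by (intro cong_mult cong_refl coeff_trinomial_power_cong_recip_square p) simp
  also have "(c\<^sup>2 - 4) * fps_nth ((Abs_fps ?u)\<^sup>2) (p - 2) =
      c * ?u (p - 1) - int p * (c * ?u (p - 1) + 2 * ?u (p - 2))"
    unfolding discriminant_mult_recip_square using pm by (simp add: algebra_simps)
  also have "[\<dots> = c * ?u (p - 1) - 0 * (c * ?u (p - 1) + 2 * ?u (p - 2))] (mod int p)"
    by (intro cong_diff cong_mult cong_refl) (simp add: cong_0_iff)
  also have "c * ?u (p - 1) - 0 * (c * ?u (p - 1) + 2 * ?u (p - 2)) = c * ((?u (Suc m))\<^sup>2 - (?u m)\<^sup>2)"
  proof -
    have "p - 1 = m + m + 2" using pm by simp
    then have "?u (p - 1) = (?u (Suc m))\<^sup>2 - (?u m)\<^sup>2"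
      by (simp only: recip_coeff_add power2_eq_square Suc_eq_plus1)
    then show ?thesis by simp
  qed
  finally show ?thesis .
qed

text \<open>The factor 2 from the folding turns n + 1 = m + 1 into p - 1, which is -1 modulo
  p.\<close>

lemma discriminant_mult_coeff_half_cong:
  fixes p m :: nat
  assumes p: "prime p" and pm: "p = 2 * m + 3"
  shows "[(c\<^sup>2 - 4) * (2 * poly.coeff ([:1, c, 1:] ^ (p - 2)) m) =
    c * recip_coeff c (Suc m) - 2 * recip_coeff c m] (mod int p)"
proof -
  let ?u = "recip_coeff c"
  have "[2 * ((c\<^sup>2 - 4) * poly.coeff ([:1, c, 1:] ^ (p - 2)) m) =
      2 * ((c\<^sup>2 - 4) * fps_nth ((Abs_fps ?u)\<^sup>2) m)] (mod int p)"
    using pm by (intro cong_mult cong_refl coeff_trinomial_power_cong_recip_square p) simp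
  also have "2 * ((c\<^sup>2 - 4) * fps_nth ((Abs_fps ?u)\<^sup>2) m) =
      c * ?u (Suc m) - 2 * ?u m - int p * (c * ?u (Suc m) + 2 * ?u m)"
    unfolding discriminant_mult_recip_square by (simp add: pm algebra_simps)
  also have "[\<dots> = c * ?u (Suc m) - 2 * ?u m - 0 * (c * ?u (Suc m) + 2 * ?u m)] (mod int p)"
    by (intro cong_diff cong_mult cong_refl) (simp add: cong_0_iff)
  finally show ?thesis by (simp add: algebra_simps)
qed

section \<open>Legendre symbols and the final case distinction\<close>

lemma Legendre_cases: "Legendre a q \<in> {- 1, 0, 1}"
  by (simp add: Legendre_def)

theorem theorem1p1:
  fixes p :: nat and c :: int
  assumes "prime p" and "odd p"
  shows "(p \<noteq> 3 \<longrightarrow> [c = 2] (mod int p) \<or> [c = - 2] (mod int p) \<longrightarrow> int p dvd det (D_mat p c)) \<and>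
    (Legendre (c\<^sup>2 - 4) (int p) = 1 \<longrightarrow>
       (\<exists>x::int. [det (D_mat p c) = x\<^sup>2 * Legendre (- c - 2) (int p)] (mod int p))) \<and>
    (Legendre (c\<^sup>2 - 4) (int p) = - 1 \<longrightarrow>
       (\<exists>x::int. [det (D_mat p c) = 2 * c * x\<^sup>2 * Legendre (- c - 2) (int p)] (mod int p)))"
proof -
  note p = \<open>prime p\<close> and odd = \<open>odd p\<close>
  have "p \<ge> 3" using p odd prime_ge_2_nat[OF p] by (cases "p = 2") auto
  from odd obtain k where k: "p = 2 * k + 1" by (elim oddE)
  define m where "m = k - 1"
  have pm: "p = 2 * m + 3" using k \<open>p \<ge> 3\<close> by (simp add: m_def)
  define \<Delta> where "\<Delta> = c\<^sup>2 - 4"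
  define \<eta> where "\<eta> = Legendre (- c - 2) (int p)"
  define \<theta> where "\<theta> = Legendre (2 - c) (int p)"
  define u where "u = recip_coeff c (Suc m)"
  define v where "v = recip_coeff c m"
  define b1 where "b1 = poly.coeff ([:1, c, 1:] ^ (p - 2)) (p - 2)"
  define b2 where "b2 = 2 * poly.coeff ([:1, c, 1:] ^ (p - 2)) m"

  have euler: "[Legendre a (int p) = a ^ Suc m] (mod int p)" for a
    using euler_criterion[OF p, of a] pm by simp
  have add: "[u + v = \<eta>] (mod int p)"
    unfolding u_def v_def \<eta>_def
    by (rule cong_trans[OF recip_coeff_add_pred_cong[OF p pm] cong_sym[OF euler]])
  have diff: "[u - v = \<theta>] (mod int p)"
    unfolding u_def v_def \<theta>_def
    by (rule cong_trans[OF recip_coeff_diff_pred_cong[OF p pm] cong_sym[OF euler]])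
  \<comment> \<open>The two bases multiply to (-c - 2) (2 - c) = c^2 - 4.\<close>
  have "[\<eta> * \<theta> = (- c - 2) ^ Suc m * (2 - c) ^ Suc m] (mod int p)"
    unfolding \<eta>_def \<theta>_def by (intro cong_mult euler)
  also have "(- c - 2) ^ Suc m * (2 - c) ^ Suc m = \<Delta> ^ Suc m"
    unfolding power_mult_distrib[symmetric] \<Delta>_def by (simp add: algebra_simps power2_eq_square)
  also have "[\<Delta> ^ Suc m = Legendre \<Delta> (int p)] (mod int p)"
    by (rule cong_sym[OF euler])
  finally have \<eta>\<theta>: "[\<eta> * \<theta> = Legendre \<Delta> (int p)] (mod int p)" .

  have cancel_2: "[x = y] (mod int p)" if "[2 * x = 2 * y] (mod int p)" for x y
    using that odd cong_mult_lcancel[of 2 "int p" x y] by simp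
  have b1: "[\<Delta> * b1 = c * Legendre \<Delta> (int p)] (mod int p)"
  proof -
    have "[\<Delta> * b1 = c * ((u + v) * (u - v))] (mod int p)"
      using discriminant_mult_coeff_central_cong[OF p pm, of c]
      by (simp add: \<Delta>_def b1_def u_def v_def algebra_simps power2_eq_square)
    also have "[c * ((u + v) * (u - v)) = c * (\<eta> * \<theta>)] (mod int p)"
      by (intro cong_mult cong_refl add diff)
    also have "[c * (\<eta> * \<theta>) = c * Legendre \<Delta> (int p)] (mod int p)"
      by (intro cong_mult cong_refl \<eta>\<theta>)
    finally show ?thesis .
  qed
  \<comment> \<open>Doubling expresses u and v by their sum and difference without
    fractions.\<close>
  have b2: "[2 * (\<Delta> * b2) = c * (\<eta> + \<theta>) - 2 * (\<eta> - \<theta>)] (mod int p)"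
  proof -
    have "[2 * (\<Delta> * b2) = 2 * (c * u - 2 * v)] (mod int p)"
      using discriminant_mult_coeff_half_cong[OF p pm, of c]
      unfolding \<Delta>_def b2_def u_def v_def by (intro cong_mult cong_refl)
    also have "2 * (c * u - 2 * v) = c * ((u + v) + (u - v)) - 2 * ((u + v) - (u - v))"
      by (simp add: algebra_simps)
    also have "[\<dots> = c * (\<eta> + \<theta>) - 2 * (\<eta> - \<theta>)] (mod int p)"
      by (intro cong_mult cong_diff cong_add cong_refl add diff)
    finally show ?thesis .
  qed

  obtain S where S: "[det (D_mat p c) = b1 * b2 * S\<^sup>2] (mod int p)"
    unfolding b1_def b2_def by (rule det_D_mat_cong_coeffs[OF p pm])
  \<comment> \<open>\<open>b1\<close> and \<open>b2\<close> are known only after multiplication by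
    \<Delta>; an inverse d of \<Delta> compensates for both factors and is absorbed into the
    square.\<close>
  have det: "\<exists>d. [det (D_mat p c) = A * B * (S * d)\<^sup>2] (mod int p)"
    if A: "[\<Delta> * b1 = A] (mod int p)" and B: "[\<Delta> * b2 = B] (mod int p)" and "Legendre \<Delta> (int p) \<noteq> 0" for A B
  proof -
    have "\<not> int p dvd \<Delta>"
      using that(3) by (auto simp: Legendre_def cong_0_iff)
    then have "coprime \<Delta> (int p)"
      using p prime_imp_coprime[of "int p" \<Delta>] by (simp add: coprime_commute)
    then obtain d where d: "[\<Delta> * d = 1] (mod int p)"
      using cong_solve_coprime_int by blast
    have "[b1 * b2 * S\<^sup>2 * 1\<^sup>2 = b1 * b2 * S\<^sup>2 * (\<Delta> * d)\<^sup>2] (mod int p)"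
      by (intro cong_mult cong_pow cong_refl cong_sym[OF d])
    also have "b1 * b2 * S\<^sup>2 * (\<Delta> * d)\<^sup>2 = (\<Delta> * b1) * (\<Delta> * b2) * (S * d)\<^sup>2"
      by (simp add: algebra_simps power2_eq_square)
    also have "[(\<Delta> * b1) * (\<Delta> * b2) * (S * d)\<^sup>2 = A * B * (S * d)\<^sup>2] (mod int p)"
      by (intro cong_mult A B cong_refl)
    finally have "[b1 * b2 * S\<^sup>2 = A * B * (S * d)\<^sup>2] (mod int p)" by simp
    with S show ?thesis by (intro exI[of _ d]) (rule cong_trans)
  qed

  have unit: "\<eta> \<in> {- 1, 0, 1}" "\<theta> \<in> {- 1, 0, 1}"
    unfolding \<eta>_def \<theta>_def by (rule Legendre_cases)+
  \<comment> \<open>Since p \<ge> 3, congruences between numbers in {-1, 0, 1} are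
    equalities.\<close>
  have small: "x = y" if "[x = y] (mod int p)" "\<bar>x - y\<bar> \<le> 2" for x y
    using that \<open>p \<ge> 3\<close> dvd_imp_le_int[of "x - y" "int p"] by (auto simp: cong_iff_dvd_diff)
  show ?thesis
  proof (intro conjI impI)
    assume "p \<noteq> 3" and "[c = 2] (mod int p) \<or> [c = - 2] (mod int p)"
    then show "int p dvd det (D_mat p c)"
      using det_D_mat_cong_0[OF p odd, of 1 c] det_D_mat_cong_0[OF p odd, of "- 1" c]
      by (auto simp: cong_0_iff)
  next
    assume \<epsilon>: "Legendre (c\<^sup>2 - 4) (int p) = 1"
    have "\<eta> * \<theta> = 1"
      using \<eta>\<theta> \<epsilon> unit by (intro small) (auto simp: \<Delta>_def)
    then have \<theta>: "\<theta> = \<eta>" using unit by auto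
    \<comment> \<open>For equal symbols the part 2 (\<eta> - \<theta>) drops out, and the factor c
      joins the one from \<open>b1\<close> to form a square.\<close>
    have "[\<Delta> * b2 = c * \<eta>] (mod int p)"
      by (rule cancel_2) (use b2 in \<open>simp add: \<theta> algebra_simps\<close>)
    then obtain d where "[det (D_mat p c) = c * (c * \<eta>) * (S * d)\<^sup>2] (mod int p)"
      using det[of c "c * \<eta>"] b1 \<epsilon> by (force simp flip: \<Delta>_def)
    then show "\<exists>x::int. [det (D_mat p c) = x\<^sup>2 * Legendre (- c - 2) (int p)] (mod int p)"
      by (intro exI[of _ "c * (S * d)"]) (simp add: \<eta>_def power2_eq_square mult_ac)
  next
    assume \<epsilon>: "Legendre (c\<^sup>2 - 4) (int p) = - 1"
    have "\<eta> * \<theta> = - 1"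
      using \<eta>\<theta> \<epsilon> unit by (intro small) (auto simp: \<Delta>_def)
    then have \<theta>: "\<theta> = - \<eta>" using unit by auto
    \<comment> \<open>For opposite symbols the part c (\<eta> + \<theta>) drops out instead, so c
      enters only through \<open>b1\<close> and stays outside the square.\<close>
    have "[\<Delta> * b2 = - 2 * \<eta>] (mod int p)"
      by (rule cancel_2) (use b2 in \<open>simp add: \<theta>\<close>)
    then obtain d where "[det (D_mat p c) = - c * (- 2 * \<eta>) * (S * d)\<^sup>2] (mod int p)"
      using det[of "- c" "- 2 * \<eta>"] b1 \<epsilon> by (force simp flip: \<Delta>_def)
    then show "\<exists>x::int. [det (D_mat p c) = 2 * c * x\<^sup>2 * Legendre (- c - 2) (int p)] (mod int p)"
      by (intro exI[of _ "S * d"]) (simp add: \<eta>_def power2_eq_square mult_ac)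
  qed
qed

end
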